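(* Let $a>0$, $\beta>0$, $\alpha>-1$, $\gamma>-1$ and $u>0$. Then $$G^{1,1}_{2,1}\left[\frac{u}{a}\,\Big|\,{-1-\gamma,\ \alpha+\beta\atop \alpha}\right]=\frac{a^{\gamma+2}}{\Gamma(\beta)}u^{-\gamma-2}\int_0^1v^{\alpha+\gamma+1}(1-v)^{\beta-1}e^{-av/u}\,dv$$ $$=\frac{a^{\gamma+2}}{\Gamma(\beta)}u^{\alpha}\int_0^{1/u}v^{\alpha+\gamma+1}(1-uv)^{\beta-1}e^{-av}\,dv$$ $$=\frac{\Gamma(2+\alpha+\gamma)}{\Gamma(2+\alpha+\gamma+\beta)}\left(\frac{u}{a}\right)^{-\gamma-2}{}_1F_1\left(2+\alpha+\gamma;2+\alpha+\gamma+\beta;-\frac{a}{u}\right).$$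
   Context: Meijer G-function: for $z>0$, $$G^{m,n}_{p,q}\left[z\,\Big|\,{a_1,\dots,a_p\atop b_1,\dots,b_q}\right]=\frac1{2\pi i}\int_{\kappa-i\infty}^{\kappa+i\infty}\frac{\prod_{j=1}^m\Gamma(b_j+s)\prod_{j=1}^n\Gamma(1-a_j-s)}{\prod_{j=m+1}^q\Gamma(1-b_j-s)\prod_{j=n+1}^p\Gamma(a_j+s)}\,z^{-s}\,ds,$$ where the real number $\kappa$ is such that all poles of $\Gamma(b_j+s)$, $j\le m$, lie to the left and all poles of $\Gamma(1-a_j-s)$, $j\le n$, lie to the right of the line $\Re s=\kappa$ (such $\kappa$ exists under the stated hypotheses). In the present case the integrand is $\frac{\Gamma(\alpha+s)\Gamma(2+\gamma-s)}{\Gamma(\alpha+\beta+s)}(u/a)^{-s}$. ${}_1F_1$ is the confluent hypergeometric series. *)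

theory Defs
  imports "HOL-Complex_Analysis.Complex_Analysis"
begin

text \<open>
  The parameter lists \<open>as\<close> and \<open>bs\<close> hold \<open>a\<^sub>1, \<dots>, a\<^sub>p\<close> and \<open>b\<^sub>1, \<dots>, b\<^sub>q\<close>, so \<open>p\<close> and \<open>q\<close> are their
  lengths and \<open>a\<^sub>j\<close> is \<open>as ! (j - 1)\<close>. Since \<^const>\<open>Gamma\<close> is \<open>0\<close> at its poles and \<open>x / 0 = 0\<close>,
  the integrand has its correct value \<open>0\<close> at the poles of the denominator.
\<close>

definition meijer_G_integrand ::
    "nat \<Rightarrow> nat \<Rightarrow> complex list \<Rightarrow> complex list \<Rightarrow> real \<Rightarrow> complex \<Rightarrow> complex" where
  "meijer_G_integrand m n as bs z s =
     ((\<Prod>j<m. Gamma (bs ! j + s)) * (\<Prod>j<n. Gamma (1 - as ! j - s))) /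
     ((\<Prod>j=m..<length bs. Gamma (1 - bs ! j - s)) * (\<Prod>j=n..<length as. Gamma (as ! j + s))) *
     complex_of_real z powr (- s)"

definition meijer_G_separating ::
    "nat \<Rightarrow> nat \<Rightarrow> complex list \<Rightarrow> complex list \<Rightarrow> real \<Rightarrow> bool" where
  "meijer_G_separating m n as bs \<kappa> \<longleftrightarrow>
     (\<forall>j<m. \<forall>s. is_pole (\<lambda>s. Gamma (bs ! j + s)) s \<longrightarrow> Re s < \<kappa>) \<and>
     (\<forall>j<n. \<forall>s. is_pole (\<lambda>s. Gamma (1 - as ! j - s)) s \<longrightarrow> \<kappa> < Re s)"

text \<open>
  \<open>w\<close> is the value of the Meijer G-function: separating lines exist, and along every one of them the
  integral over \<open>s = \<kappa> + i t\<close>, with \<open>ds = i dt\<close>, converges to \<open>2 \<pi> i w\<close>. The gauge integral over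
  the whole real line includes conditionally convergent improper integrals.
\<close>

definition has_meijer_G ::
    "nat \<Rightarrow> nat \<Rightarrow> complex list \<Rightarrow> complex list \<Rightarrow> real \<Rightarrow> complex \<Rightarrow> bool" where
  "has_meijer_G m n as bs z w \<longleftrightarrow>
     (\<exists>\<kappa>. meijer_G_separating m n as bs \<kappa>) \<and>
     (\<forall>\<kappa>. meijer_G_separating m n as bs \<kappa> \<longrightarrow>
        ((\<lambda>t. meijer_G_integrand m n as bs z (Complex \<kappa> t) * \<i>)
           has_integral (2 * of_real pi * \<i> * w)) UNIV)"

definition meijer_G ::
    "nat \<Rightarrow> nat \<Rightarrow> complex list \<Rightarrow> complex list \<Rightarrow> real \<Rightarrow> complex" where
  "meijer_G m n as bs z = (THE w. has_meijer_G m n as bs z w)"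

definition hypergeometric_1F1 :: "real \<Rightarrow> real \<Rightarrow> real \<Rightarrow> real" where
  "hypergeometric_1F1 b c x = eval_fps (fps_hypergeo [b] [c] 1) x"

end

theory Submission
  imports Defs "HOL-Probability.Characteristic_Functions" "HOL-Probability.Sinc_Integral"
begin

text \<open>
  In the integrand \<open>Gamma (\<alpha> + s) Gamma (2 + \<gamma> - s) / Gamma (\<alpha> + \<beta> + s) z\<^bsup>-s\<^esup>\<close>, with \<open>z = u / a\<close>, the
  quotient of Gamma functions of \<open>\<alpha> + s\<close> and \<open>\<alpha> + \<beta> + s\<close> is, up to the factor \<open>1 / Gamma \<beta>\<close>, the Mellin
  transform of \<open>v\<^bsup>\<alpha>\<^esup> (1 - v)\<^bsup>\<beta> - 1\<^esup>\<close> on \<open>0 < v < 1\<close>, and \<open>Gamma (2 + \<gamma> - s)\<close> is, up to reflection, the Mellin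
  transform of an exponential. A product of Mellin transforms inverts to a multiplicative convolution,
  and this convolution is the integral over \<open>v\<close> in the theorem.

  Three facts make this rigorous. The Beta integral is needed for complex exponents
  (\<open>Beta_integral_complex\<close>). The formula \<open>\<integral> Gamma (\<sigma> + i t) y\<^bsup>-\<sigma> - i t\<^esup> dt = 2 \<pi> exp (-y)\<close>
  (\<open>Cahen_Mellin_inversion\<close>) is obtained by Fourier inversion, so that neither contour shifts nor
  residue sums occur. Finally, Gamma is absolutely integrable along vertical lines in the right
  half-plane (\<open>integrable_Gamma_vertical_line\<close>), and this is all the decay that Fubini's theorem asks
  for in \<open>Gamma_quotient_vertical_integral\<close>. The value found does not depend on the line chosen among
  the separating ones, so the G-function is well defined.

  The second integral is a rescaling of the first, and the hypergeometric form is Euler's integral,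
  obtained by expanding the exponential (\<open>hypergeometric_1F1_Euler_integral\<close>).
\<close>

section \<open>Fourier inversion on the real line\<close>

lemma integral_swap_of_product_bound:
  fixes F :: "real \<Rightarrow> real \<Rightarrow> complex" and G H :: "real \<Rightarrow> real"
  assumes F [measurable]: "case_prod F \<in> borel_measurable (lborel \<Otimes>\<^sub>M lborel)"
    and G: "integrable lborel G" and H: "integrable lborel H"
    and bound: "\<And>x t. norm (F x t) \<le> G x * H t"
  shows "(LINT t|lborel. LINT x|lborel. F x t) = (LINT x|lborel. LINT t|lborel. F x t)"
    and "integrable lborel (\<lambda>t. LINT x|lborel. F x t)"
proof -
  note [measurable] = borel_measurable_integrable[OF G] borel_measurable_integrable[OF H]
  have GH: "integrable (lborel \<Otimes>\<^sub>M lborel) (\<lambda>p. G (fst p) * H (snd p))"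
    by (rule lborel_pair.Fubini_integrable) (auto simp: abs_mult G H)
  have F_int: "integrable (lborel \<Otimes>\<^sub>M lborel) (case_prod F)"
  proof (rule Bochner_Integration.integrable_bound[OF GH])
    show "AE p in lborel \<Otimes>\<^sub>M lborel. norm (case_prod F p) \<le> norm (G (fst p) * H (snd p))"
      using bound by (intro AE_I2) (auto intro: order_trans[OF _ abs_ge_self])
  qed fact
  show "(LINT t|lborel. LINT x|lborel. F x t) = (LINT x|lborel. LINT t|lborel. F x t)"
    by (rule lborel_pair.Fubini_integral[OF F_int])
  show "integrable lborel (\<lambda>t. LINT x|lborel. F x t)"
    by (rule lborel_pair.integrable_snd[OF F_int])
qed

lemma fourier_std_normal_density:
  "(LINT w|lborel. std_normal_density w *\<^sub>R iexp (s * w)) = exp (- (s ^ 2) / 2)"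
  using fun_cong[OF char_std_normal_distribution, of s]
  by (simp add: char_def integral_density)

lemma fourier_scaled_gaussian:
  assumes "e > (0::real)"
  shows "(LINT t|lborel. exp (- ((e * t) ^ 2) / 2) *\<^sub>R iexp (t * s))
       = complex_of_real (2 * pi / e * std_normal_density (s / e))"
proof -
  have "(LINT t|lborel. exp (- ((e * t) ^ 2) / 2) *\<^sub>R iexp (t * s))
      = sqrt (2 * pi) *\<^sub>R (LINT t|lborel. std_normal_density (e * t) *\<^sub>R iexp (s / e * (e * t)))"
    using assms by (simp add: std_normal_density_def mult_ac flip: integral_scaleR_right)
  also have "(LINT t|lborel. std_normal_density (e * t) *\<^sub>R iexp (s / e * (e * t)))
      = (1 / e) *\<^sub>R (LINT w|lborel. std_normal_density w *\<^sub>R iexp (s / e * w))"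
    using assms
    by (subst lborel_integral_real_affine[of e "\<lambda>w. std_normal_density w *\<^sub>R iexp (s / e * w)" 0]) auto
  also have "sqrt (2 * pi) *\<^sub>R \<dots> = complex_of_real (2 * pi / e * std_normal_density (s / e))"
    unfolding fourier_std_normal_density using assms
    by (simp add: std_normal_density_def scaleR_conv_of_real field_simps flip: of_real_mult)
  finally show ?thesis .
qed

text \<open>
  The transform is damped by the Gaussian \<open>exp (-(e t)\<^sup>2 / 2)\<close>. Interchanging the two integrations then
  turns the damped inversion integral into \<open>2 \<pi>\<close> times the mean of \<open>g (y + e W)\<close> over a standard
  normal \<open>W\<close>, because a Gaussian is its own Fourier transform. As \<open>e \<rightarrow> 0\<close>, dominated convergence applies
  on both sides: boundedness and continuity of \<open>g\<close> give \<open>2 \<pi> g(y)\<close> on one of them, and integrability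
  of the transform removes the damping on the other.
\<close>

lemma fourier_inversion:
  fixes g :: "real \<Rightarrow> complex"
  assumes g: "integrable lborel g" and cont: "\<And>x. isCont g x" and bdd: "\<And>x. norm (g x) \<le> B"
    and h: "integrable lborel (\<lambda>t. LINT x|lborel. g x * iexp (t * x))" (is "integrable _ ?h")
  shows "(LINT t|lborel. ?h t * iexp (- (t * y))) = 2 * pi * g y"
proof -
  define e where "e n = inverse (real (Suc n))" for n
  have e_pos: "e n > 0" for n by (simp add: e_def)
  have e_lim: "e \<longlonglongrightarrow> 0" unfolding e_def by (rule LIMSEQ_inverse_real_of_nat)
  define A where "A n = (LINT t|lborel. exp (- ((e n * t) ^ 2) / 2) *\<^sub>R (?h t * iexp (- (t * y))))" for n
  have [measurable]: "g \<in> borel_measurable borel" "?h \<in> borel_measurable borel"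
    using borel_measurable_integrable[OF g] borel_measurable_integrable[OF h] by auto
  have gauss_int: "integrable lborel (\<lambda>t. exp (- ((e n * t) ^ 2) / 2))" for n
  proof -
    have "integrable lborel (\<lambda>t. sqrt (2 * pi) * std_normal_density (0 + e n * t))"
      using e_pos[of n] integrable_normal_density[of 1 0]
      by (intro integrable_mult_right lborel_integrable_real_affine) auto
    then show ?thesis by (simp add: std_normal_density_def)
  qed
  have split: "iexp (t * (x - y)) = iexp (t * x) * iexp (- (t * y))" for t x
    by (simp add: algebra_simps flip: exp_add)
  have A_eq: "A n = 2 * pi * (LINT w|lborel. std_normal_density w *\<^sub>R g (y + e n * w))" for n
  proof -
    \<comment> \<open>The damping makes the double integral absolutely convergent: its integrand is bounded by \<open>\<bar>g x\<bar>\<close> times a Gaussian in \<open>t\<close>.\<close>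
    have "A n = (LINT t|lborel. LINT x|lborel. exp (- ((e n * t) ^ 2) / 2) *\<^sub>R (g x * iexp (t * (x - y))))"
      unfolding A_def split mult.assoc[symmetric] integral_scaleR_right integral_mult_left_zero ..
    also have "\<dots> = (LINT x|lborel. LINT t|lborel. exp (- ((e n * t) ^ 2) / 2) *\<^sub>R (g x * iexp (t * (x - y))))"
      by (rule integral_swap_of_product_bound(1)[where G = "\<lambda>x. norm (g x)", OF _ _ gauss_int[of n]])
         (auto simp: norm_mult g intro!: borel_measurable_continuous_onI)
    also have "\<dots> = (LINT x|lborel. g x * complex_of_real (2 * pi / e n * std_normal_density ((x - y) / e n)))"
      unfolding fourier_scaled_gaussian[OF e_pos, symmetric]
      by (simp add: mult_ac flip: integral_mult_right_zero)
    also have "\<dots> = e n *\<^sub>R (LINT w|lborel. g (y + e n * w) * complex_of_real (2 * pi / e n * std_normal_density w))"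
      using e_pos[of n] by (subst lborel_integral_real_affine[of "e n" _ y]) auto
    also have "\<dots> = 2 * pi * (LINT w|lborel. std_normal_density w *\<^sub>R g (y + e n * w))"
      unfolding integral_scaleR_right[symmetric] integral_mult_right_zero[symmetric]
      using e_pos[of n]
      by (intro Bochner_Integration.integral_cong refl) (simp add: scaleR_conv_of_real field_simps)
    finally show ?thesis .
  qed
  have "(\<lambda>n. LINT w|lborel. std_normal_density w *\<^sub>R g (y + e n * w))
      \<longlonglongrightarrow> (LINT w|lborel. std_normal_density w *\<^sub>R g y)"
  proof (rule integral_dominated_convergence[where w = "\<lambda>w. std_normal_density w * B"])
    show "integrable lborel (\<lambda>w. std_normal_density w * B)"
      using integrable_normal_density[of 1 0] by simp
    show "AE w in lborel. (\<lambda>n. std_normal_density w *\<^sub>R g (y + e n * w)) \<longlonglongrightarrow> std_normal_density w *\<^sub>R g y"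
    proof (intro AE_I2 tendsto_scaleR tendsto_const)
      fix w
      have "(\<lambda>n. y + e n * w) \<longlonglongrightarrow> y"
        by (rule tendsto_eq_intros e_lim refl)+ simp
      then show "(\<lambda>n. g (y + e n * w)) \<longlonglongrightarrow> g y"
        by (rule isCont_tendsto_compose[OF cont])
    qed
    show "AE w in lborel. norm (std_normal_density w *\<^sub>R g (y + e n * w)) \<le> std_normal_density w * B" for n
      using bdd by (intro AE_I2) (auto intro!: mult_left_mono)
  qed auto
  also have "(LINT w|lborel. std_normal_density w *\<^sub>R g y) = g y"
    using integrable_normal_density[of 1 0] integral_normal_density[of 1 0] by simp
  finally have "A \<longlonglongrightarrow> 2 * pi * g y"
    unfolding A_eq by (intro tendsto_mult tendsto_const)
  moreover have "A \<longlonglongrightarrow> (LINT t|lborel. ?h t * iexp (- (t * y)))"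
    unfolding A_def
  proof (rule integral_dominated_convergence[where w = "\<lambda>t. norm (?h t)"])
    show "AE t in lborel. (\<lambda>n. exp (- ((e n * t) ^ 2) / 2) *\<^sub>R (?h t * iexp (- (t * y))))
        \<longlonglongrightarrow> ?h t * iexp (- (t * y))"
      by (intro AE_I2) (rule tendsto_eq_intros e_lim refl | simp)+
    show "AE t in lborel. norm (exp (- ((e n * t) ^ 2) / 2) *\<^sub>R (?h t * iexp (- (t * y)))) \<le> norm (?h t)" for n
      by (intro AE_I2) (auto simp: norm_mult intro!: mult_left_le_one_le)
  qed (use h in auto)
  ultimately show ?thesis
    using LIMSEQ_unique by blast
qed

section \<open>The Gamma function on vertical lines\<close>

lemma Re_pos_not_nonpos_Int: "Re z > 0 \<Longrightarrow> z \<notin> \<int>\<^sub>\<le>\<^sub>0"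
  by (auto elim!: nonpos_Ints_cases)

lemma has_bochner_integral_Gamma:
  fixes s :: complex
  assumes "Re s > 0"
  shows "has_bochner_integral lborel
           (\<lambda>x. indicator {0<..} x *\<^sub>R (complex_of_real x powr (s - 1) / of_real (exp x))) (Gamma s)"
proof -
  let ?f = "\<lambda>x. complex_of_real x powr (s - 1) / of_real (exp x)"
  have int: "set_integrable lborel {0<..} ?f"
    using absolutely_integrable_Gamma_integral'[OF assms]
    unfolding set_integrable_def by (subst (asm) integrable_completion) (auto intro!: borel_measurable_continuous_on_indicator continuous_intros)
  moreover have "(LINT x:{0<..}|lborel. ?f x) = Gamma s"
    using set_borel_integral_eq_integral(2)[OF int] Gamma_integral_complex'[OF assms]
    by (simp add: integral_unique)
  ultimately show ?thesis
    by (simp add: has_bochner_integral_iff set_integrable_def set_lebesgue_integral_def)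
qed

text \<open>
  The substitution \<open>x \<mapsto> exp x\<close> turns the Mellin transform of \<open>exp (-x)\<close> into an integral over the whole
  line, so that \<open>t \<mapsto> Gamma (\<sigma> + i t)\<close> is the Fourier transform of \<open>x \<mapsto> exp (\<sigma> x - exp x)\<close>.
\<close>

lemma has_bochner_integral_Gamma_exp:
  fixes s :: complex
  assumes "Re s > 0"
  shows "has_bochner_integral lborel (\<lambda>x. of_real (exp (- exp x)) * exp (s * of_real x)) (Gamma s)"
proof -
  let ?f = "\<lambda>x. complex_of_real x powr (s - 1) / of_real (exp x)"
  have range_exp: "range exp = {0::real<..}"
    by (auto simp: image_iff) (metis exp_ln)
  have "?f absolutely_integrable_on exp ` UNIV \<and> integral (exp ` UNIV) ?f = Gamma s"
    using absolutely_integrable_Gamma_integral'[OF assms] Gamma_integral_complex'[OF assms]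
    unfolding range_exp by (simp add: integral_unique)
  then have *: "(\<lambda>x. \<bar>exp x\<bar> *\<^sub>R ?f (exp x)) absolutely_integrable_on UNIV \<and>
      integral UNIV (\<lambda>x. \<bar>exp x\<bar> *\<^sub>R ?f (exp x)) = Gamma s"
    by (subst has_absolute_integral_change_of_variables_real)
      (auto intro!: derivative_eq_intros injI)
  have eq: "\<bar>exp x\<bar> *\<^sub>R ?f (exp x) = of_real (exp (- exp x)) * exp (s * of_real x)" for x :: real
  proof -
    have "complex_of_real (exp x) powr (s - 1) = exp (s * of_real x) / of_real (exp x)"
      by (simp add: powr_def Ln_of_real algebra_simps exp_diff exp_of_real)
    then show ?thesis
      by (simp add: scaleR_conv_of_real exp_minus divide_inverse)
  qed
  have "integrable lborel (\<lambda>x. of_real (exp (- exp x)) * exp (s * of_real x))"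
    using * unfolding eq set_integrable_def
    by (subst (asm) integrable_completion) (auto intro!: borel_measurable_continuous_onI continuous_intros)
  with * show ?thesis
    unfolding eq by (simp add: has_bochner_integral_iff integral_lborel)
qed

lemma norm_Gamma_le_Gamma_Re:
  fixes s :: complex
  assumes "Re s > 0"
  shows "norm (Gamma s) \<le> Gamma (Re s)"
proof -
  have hb: "has_bochner_integral lborel (\<lambda>x. of_real (exp (- exp x)) * exp (of_real (Re s) * of_real x))
      (Gamma (complex_of_real (Re s)))"
    using assms by (intro has_bochner_integral_Gamma_exp) simp
  have "norm (Gamma s) \<le> (LINT x|lborel. norm (of_real (exp (- exp x)) * exp (s * of_real x)))"
    unfolding has_bochner_integral_integral_eq[OF has_bochner_integral_Gamma_exp[OF assms], symmetric]
    by (rule integral_norm_bound)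
  also have "\<dots> = (LINT x|lborel. Re (of_real (exp (- exp x)) * exp (of_real (Re s) * of_real x)))"
    by (intro Bochner_Integration.integral_cong) (auto simp: norm_mult Re_exp)
  also have "\<dots> = Re (Gamma (of_real (Re s)))"
    using integral_Re[OF integrable.intros[OF hb]] has_bochner_integral_integral_eq[OF hb] by metis
  finally show ?thesis
    by (simp add: Gamma_complex_of_real)
qed

text \<open>
  Stirling's formula gives exponential decay, but quadratic decay is enough and is elementary:
  \<open>\<bar>Gamma (s + 2)\<bar> = \<bar>s + 1\<bar> \<bar>s\<bar> \<bar>Gamma s\<bar>\<close>, and the left-hand side is at most \<open>Gamma (Re s + 2)\<close>.
\<close>

lemma integrable_Gamma_vertical_line:
  assumes "\<sigma> > (0::real)"
  shows "integrable lborel (\<lambda>t. Gamma (Complex \<sigma> t))"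
proof -
  define C where "C = Gamma (\<sigma> + 2) * (1 + 1 / \<sigma>\<^sup>2)"
  have bound: "norm (Gamma (Complex \<sigma> t)) \<le> C * inverse (1 + t\<^sup>2)" for t
  proof -
    define s where "s = Complex \<sigma> t"
    have Re: "Re s = \<sigma>" by (simp add: s_def)
    have "Gamma (s + 2) = (s + 1) * (s * Gamma s)"
      using Gamma_plus1[of s] Gamma_plus1[of "s + 1"] Re_pos_not_nonpos_Int[of s] Re_pos_not_nonpos_Int[of "s + 1"] assms
      by (simp add: Re add.assoc)
    then have "norm (Gamma (s + 2)) = norm (s + 1) * norm s * norm (Gamma s)"
      by (simp add: norm_mult)
    moreover have "norm s * norm s \<le> norm (s + 1) * norm s"
      using assms by (intro mult_right_mono) (auto simp: s_def cmod_def complex_eq_iff)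
    moreover have "norm s * norm s = \<sigma>\<^sup>2 + t\<^sup>2"
      by (simp add: s_def cmod_def)
    ultimately have "(\<sigma>\<^sup>2 + t\<^sup>2) * norm (Gamma s) \<le> norm (Gamma (s + 2))"
      by (metis mult_right_mono norm_ge_zero)
    also have "\<dots> \<le> Gamma (\<sigma> + 2)"
      using norm_Gamma_le_Gamma_Re[of "s + 2"] assms by (simp add: Re)
    finally have 1: "(\<sigma>\<^sup>2 + t\<^sup>2) * norm (Gamma s) \<le> Gamma (\<sigma> + 2)" .
    have "(1 + t\<^sup>2) * norm (Gamma s) \<le> (1 + 1 / \<sigma>\<^sup>2) * ((\<sigma>\<^sup>2 + t\<^sup>2) * norm (Gamma s))"
      unfolding mult.assoc[symmetric]
      using assms by (intro mult_right_mono) (auto simp: field_simps)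
    also have "\<dots> \<le> (1 + 1 / \<sigma>\<^sup>2) * Gamma (\<sigma> + 2)"
      using 1 assms by (intro mult_left_mono) auto
    finally show ?thesis
      unfolding C_def s_def by (simp add: field_simps add_pos_nonneg)
  qed
  have dom: "integrable lborel (\<lambda>t. C * inverse (1 + t\<^sup>2))"
    using integrable_inverse_1_plus_square by (simp add: set_integrable_def einterval_def)
  have "continuous_on UNIV (\<lambda>t. Gamma (\<sigma> + \<i> * complex_of_real t))"
    using assms by (intro continuous_on_compose2[OF continuous_on_Gamma[of "{z. Re z > 0}"]])
      (auto elim!: nonpos_Ints_cases intro!: continuous_intros)
  then have "(\<lambda>t. Gamma (Complex \<sigma> t)) \<in> borel_measurable lborel"
    by (simp add: Complex_eq borel_measurable_continuous_onI)
  then show ?thesis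
    by (rule Bochner_Integration.integrable_bound[OF dom]) (use bound in \<open>auto intro: order_trans[OF _ abs_ge_self]\<close>)
qed

text \<open>
  This is Fourier inversion at the point \<open>ln y\<close> for the function \<open>x \<mapsto> exp (\<sigma> x - exp x)\<close>, whose
  transform is \<open>Gamma (\<sigma> + i t)\<close>.
\<close>

lemma Cahen_Mellin_inversion:
  assumes \<sigma>: "\<sigma> > (0::real)" and y: "y > (0::real)"
  shows "(LINT t|lborel. Gamma (Complex \<sigma> t) * of_real y powr (- Complex \<sigma> t)) = 2 * pi * exp (- y)"
proof -
  define g where "g x = complex_of_real (exp (- exp x)) * exp (of_real \<sigma> * of_real x)" for x
  have g_mult: "g x * iexp (t * x) = of_real (exp (- exp x)) * exp (Complex \<sigma> t * of_real x)" for t x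
    by (simp add: g_def Complex_eq algebra_simps flip: exp_add)
  have transform: "(LINT x|lborel. g x * iexp (t * x)) = Gamma (Complex \<sigma> t)" for t
    unfolding g_mult
    using \<sigma> by (intro has_bochner_integral_integral_eq has_bochner_integral_Gamma_exp) simp
  have "(LINT t|lborel. (LINT x|lborel. g x * iexp (t * x)) * iexp (- (t * ln y))) = 2 * pi * g (ln y)"
  proof (rule fourier_inversion)
    show "integrable lborel g"
      using has_bochner_integral_Gamma_exp[of "of_real \<sigma>"] \<sigma>
      by (simp add: g_def[abs_def] has_bochner_integral_iff)
    show "isCont g x" for x
      unfolding g_def[abs_def] by (intro continuous_intros)
    show "norm (g x) \<le> exp (\<sigma> * (ln \<sigma> - 1))" for x
    proof -
      \<comment> \<open>The function \<open>\<sigma> x - exp x\<close> has its maximum at \<open>ln \<sigma>\<close>, so \<open>exp\<close> is compared with its tangent there.\<close>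
      have "\<sigma> * (1 + (x - ln \<sigma>)) \<le> \<sigma> * exp (x - ln \<sigma>)"
        using \<sigma> by (intro mult_left_mono exp_ge_add_one_self) simp
      also have "\<dots> = exp x"
        using \<sigma> by (simp add: exp_diff)
      finally show ?thesis
        by (simp add: g_def norm_mult algebra_simps flip: exp_add)
    qed
    show "integrable lborel (\<lambda>t. LINT x|lborel. g x * iexp (t * x))"
      unfolding transform by (rule integrable_Gamma_vertical_line[OF \<sigma>])
  qed
  then have *: "(LINT t|lborel. Gamma (Complex \<sigma> t) * iexp (- (t * ln y))) = 2 * pi * g (ln y)"
    unfolding transform .
  have "of_real y powr (- Complex \<sigma> t) = of_real (y powr (- \<sigma>)) * iexp (- (t * ln y))" for t
    using y by (simp add: powr_def Ln_of_real Complex_eq algebra_simps flip: exp_add exp_of_real)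
  then have "(LINT t|lborel. Gamma (Complex \<sigma> t) * of_real y powr (- Complex \<sigma> t))
      = of_real (y powr (- \<sigma>)) * (LINT t|lborel. Gamma (Complex \<sigma> t) * iexp (- (t * ln y)))"
    by (simp only: mult.left_commute[of _ "of_real (y powr (- \<sigma>))"] integral_mult_right_zero)
  also have "\<dots> = of_real (y powr (- \<sigma>)) * (2 * pi * (of_real (exp (- y)) * of_real (y powr \<sigma>)))"
    unfolding * using y by (simp add: g_def powr_def mult.commute flip: exp_of_real)
  also have "\<dots> = 2 * pi * exp (- y)"
    using y by (simp add: powr_minus)
  finally show ?thesis .
qed

section \<open>The Beta integral with complex parameters\<close>

lemma integral_convolution:
  fixes f g :: "real \<Rightarrow> complex"
  assumes f: "integrable lborel f" and g: "integrable lborel g"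
  shows "(LINT r|lborel. LINT t|lborel. f t * g (r - t)) = (LINT t|lborel. f t) * (LINT y|lborel. g y)"
proof -
  have [measurable]: "f \<in> borel_measurable borel" "g \<in> borel_measurable borel"
    using borel_measurable_integrable[OF f] borel_measurable_integrable[OF g] by auto
  have shift: "(LINT r|lborel. h (r - t)) = (LINT y|lborel. h y)" for t :: real and h :: "real \<Rightarrow> 'a::{banach, second_countable_topology}"
    using lborel_integral_real_affine[of 1 h "- t"] by simp
  have shift_int: "integrable lborel (\<lambda>r. g (r - t))" for t
    using lborel_integrable_real_affine[OF g, of 1 "- t"] by simp
  have "integrable (lborel \<Otimes>\<^sub>M lborel) (\<lambda>(t, r). f t * g (r - t))"
    by (rule lborel_pair.Fubini_integrable)
       (auto simp: norm_mult shift[of "\<lambda>y. norm (g y)"] f shift_int intro: integrable_norm)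
  then have "(LINT r|lborel. LINT t|lborel. f t * g (r - t)) = (LINT t|lborel. LINT r|lborel. f t * g (r - t))"
    by (rule lborel_pair.Fubini_integral)
  also have "\<dots> = (LINT t|lborel. f t * (LINT y|lborel. g y))"
    by (simp add: shift)
  finally show ?thesis by simp
qed

text \<open>
  With \<open>\<phi>\<^sub>s x = x\<^bsup>s - 1\<^esup> exp (-x)\<close> on \<open>x > 0\<close>, the convolution of \<open>\<phi>\<^sub>a\<close> and \<open>\<phi>\<^sub>b\<close> at \<open>r\<close> is, after the scaling
  \<open>t = r v\<close>, equal to \<open>\<phi>\<^bsub>a + b\<^esub> r\<close> times the Beta integral. The total integral of a convolution is the
  product of the total integrals, and \<open>\<phi>\<^sub>s\<close> integrates to \<open>Gamma s\<close>.
\<close>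

lemma Beta_integral_complex:
  fixes a b :: complex
  assumes a: "Re a > 0" and b: "Re b > 0"
  shows "(LINT v|lborel. indicator {0<..<1} v *\<^sub>R (complex_of_real v powr (a - 1) * of_real (1 - v) powr (b - 1)))
       = Beta a b" (is "?B = _")
proof -
  define \<phi> where "\<phi> s x = indicator {0<..} x *\<^sub>R (complex_of_real x powr (s - 1) / of_real (exp x))" for s x
  have \<phi>: "integrable lborel (\<phi> s)" "(LINT x|lborel. \<phi> s x) = Gamma s" if "Re s > 0" for s
    using has_bochner_integral_Gamma[OF that] by (simp_all add: \<phi>_def[abs_def] has_bochner_integral_iff)
  have inner: "(LINT t|lborel. \<phi> a t * \<phi> b (r - t)) = \<phi> (a + b) r * ?B" for r
  proof (cases "r > 0")
    case True
    have scaled: "r *\<^sub>R (\<phi> a (r * v) * \<phi> b (r - r * v))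
        = \<phi> (a + b) r * (indicator {0<..<1} v *\<^sub>R (complex_of_real v powr (a - 1) * of_real (1 - v) powr (b - 1)))" for v
    proof (cases "v \<in> {0<..<1}")
      case v: True
      have "r - r * v = r * (1 - v)" by (simp add: algebra_simps)
      moreover have "r * (1 - v) > 0" "r * v > 0" using True v by auto
      moreover have "complex_of_real (r * v) powr (a - 1) = of_real r powr (a - 1) * of_real v powr (a - 1)"
        "complex_of_real (r * (1 - v)) powr (b - 1) = of_real r powr (b - 1) * of_real (1 - v) powr (b - 1)"
        unfolding of_real_mult using True v by (intro powr_times_real; simp)+
      moreover have "of_real r * (complex_of_real r powr (a - 1) * of_real r powr (b - 1)) = of_real r powr (a + b - 1)"
        using True by (simp add: powr_diff powr_add)
      moreover have "exp r = exp (r * v) * exp (r * (1 - v))"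
        by (simp add: algebra_simps flip: exp_add)
      ultimately show ?thesis
        using True v unfolding \<phi>_def by (simp add: scaleR_conv_of_real)
    next
      case False
      then have "r * v \<le> 0 \<or> r - r * v \<le> 0"
        using True by (auto simp: mult_le_0_iff)
      with False show ?thesis
        by (auto simp: \<phi>_def)
    qed
    have "(LINT t|lborel. \<phi> a t * \<phi> b (r - t)) = (LINT v|lborel. r *\<^sub>R (\<phi> a (r * v) * \<phi> b (r - r * v)))"
      using True by (subst lborel_integral_real_affine[of r _ 0]) auto
    then show ?thesis
      unfolding scaled integral_mult_right_zero .
  next
    case False
    then have zero: "\<phi> a t * \<phi> b (r - t) = 0" for t
      by (auto simp: \<phi>_def split: split_indicator)
    from False show ?thesis unfolding zero by (simp add: \<phi>_def)
  qed
  have "Gamma a * Gamma b = (LINT r|lborel. \<phi> (a + b) r * ?B)"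
    using integral_convolution[OF \<phi>(1)[OF a] \<phi>(1)[OF b]] unfolding inner \<phi>(2)[OF a] \<phi>(2)[OF b] ..
  also have "\<dots> = Gamma (a + b) * ?B"
    using \<phi>(2)[of "a + b"] a b by simp
  finally have "Gamma a * Gamma b = Gamma (a + b) * ?B" .
  moreover have "Gamma (a + b) \<noteq> 0"
    using a b by (simp add: Gamma_eq_zero_iff Re_pos_not_nonpos_Int)
  ultimately show ?thesis
    by (simp add: Beta_def field_simps)
qed

section \<open>The vertical line integral\<close>

text \<open>
  The Beta integral writes \<open>Gamma (\<alpha> + s) / Gamma (\<alpha> + \<beta> + s)\<close> as a weighted integral of \<open>v\<^bsup>s\<^esup>\<close>
  over \<open>0 < v < 1\<close>. Along the line, \<open>v\<^bsup>s\<^esup>\<close> has constant modulus and \<open>Gamma (c - s)\<close> is integrable, so the \<open>s\<close>-integration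
  may be carried out first. What remains is the inverse Mellin transform of \<open>Gamma (c - s)\<close> at \<open>v / z\<close>,
  which contributes \<open>2 \<pi> (v / z)\<^bsup>c\<^esup> exp (-v / z)\<close>.
\<close>

lemma Gamma_quotient_vertical_integral:
  fixes \<alpha> \<beta> c \<kappa> z :: real
  assumes \<beta>: "\<beta> > 0" and \<kappa>: "- \<alpha> < \<kappa>" "\<kappa> < c" and z: "z > 0"
  defines "\<Phi> \<equiv> (\<lambda>s. Gamma (of_real \<alpha> + s) * Gamma (of_real c - s) / Gamma (of_real (\<alpha> + \<beta>) + s)
                      * complex_of_real z powr (- s))"
  shows "has_bochner_integral lborel (\<lambda>t. \<Phi> (Complex \<kappa> t))
           (2 * pi * (z powr (- c) / Gamma \<beta> *
             (LINT v:{0..1}|lborel. v powr (\<alpha> + c - 1) * (1 - v) powr (\<beta> - 1) * exp (- v / z))))"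
proof -
  define G where "G v = indicator {0..1} v * (v powr (\<alpha> + \<kappa> - 1) * (1 - v) powr (\<beta> - 1))" for v :: real
  define H where "H t = Gamma (of_real c - Complex \<kappa> t) * complex_of_real z powr (- Complex \<kappa> t)" for t
  \<comment> \<open>The double integrand, with \<open>v\<^bsup>s\<^esup>\<close> split into its modulus, which goes into \<open>G\<close>, and its phase.\<close>
  define K where "K v t = of_real (G v) * (iexp (t * ln v) * H t)" for v t
  \<comment> \<open>On the line, \<open>c - s\<close> runs through \<open>Re = c - \<kappa>\<close> downwards; the affine form prepares the reflection \<open>t \<mapsto> -t\<close>.\<close>
  have Gamma_refl: "(\<lambda>t. Gamma (of_real c - Complex \<kappa> t)) = (\<lambda>t. Gamma (Complex (c - \<kappa>) (0 + (-1) * t)))"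
    by (simp add: fun_eq_iff Complex_eq algebra_simps)
  have Gamma_int: "integrable lborel (\<lambda>t. Gamma (of_real c - Complex \<kappa> t))"
    unfolding Gamma_refl using \<kappa>
    by (intro lborel_integrable_real_affine[of "\<lambda>t. Gamma (Complex (c - \<kappa>) t)"] integrable_Gamma_vertical_line) auto
  have G_int: "integrable lborel G"
    using integrable_Beta[of "\<alpha> + \<kappa>" \<beta>] \<kappa> \<beta> by (simp add: G_def[abs_def] set_integrable_def)
  have z_powr: "complex_of_real z powr (- Complex \<kappa> t) = of_real (z powr (- \<kappa>)) * iexp (- (t * ln z))" for t
    using z by (simp add: powr_def Ln_of_real Complex_eq algebra_simps flip: exp_add exp_of_real)
  note [measurable] = borel_measurable_integrable[OF Gamma_int] borel_measurable_integrable[OF G_int]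
  have H_int: "integrable lborel H"
    by (rule Bochner_Integration.integrable_bound[OF integrable_mult_left[OF Gamma_int, of "of_real (z powr (- \<kappa>))"]])
       (simp_all add: H_def[abs_def] z_powr norm_mult)
  note [measurable] = borel_measurable_integrable[OF H_int]
  have swap: "(LINT t|lborel. LINT v|lborel. K v t) = (LINT v|lborel. LINT t|lborel. K v t)"
    and K_int: "integrable lborel (\<lambda>t. LINT v|lborel. K v t)"
  proof -
    have meas: "case_prod K \<in> borel_measurable (lborel \<Otimes>\<^sub>M lborel)"
      unfolding K_def[abs_def] by measurable
    have bound: "norm (K v t) \<le> G v * norm (H t)" for v t
      by (simp add: K_def norm_mult G_def)
    show "(LINT t|lborel. LINT v|lborel. K v t) = (LINT v|lborel. LINT t|lborel. K v t)"
      and "integrable lborel (\<lambda>t. LINT v|lborel. K v t)"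
      using integral_swap_of_product_bound[OF meas G_int integrable_norm[OF H_int] bound] by auto
  qed
  have inner_v: "(LINT v|lborel. K v t) = Gamma \<beta> * \<Phi> (Complex \<kappa> t)" for t
  proof -
    let ?s = "Complex \<kappa> t"
    have K_eq: "K v t = indicator {0<..<1} v *\<^sub>R (complex_of_real v powr ((of_real \<alpha> + ?s) - 1) * of_real (1 - v) powr (of_real \<beta> - 1)) * H t" for v
    proof (cases "v \<in> {0<..<1}")
      case True
      have "complex_of_real v powr ((of_real \<alpha> + ?s) - 1) = of_real (v powr (\<alpha> + \<kappa> - 1)) * iexp (t * ln v)"
        using True by (simp add: powr_def Ln_of_real Complex_eq algebra_simps flip: exp_add exp_of_real)
      moreover have "complex_of_real (1 - v) powr (of_real \<beta> - 1) = of_real ((1 - v) powr (\<beta> - 1))"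
        using True by (subst powr_of_real[symmetric]) auto
      ultimately show ?thesis
        using True by (simp add: K_def G_def)
    next
      case False
      then have "v = 0 \<or> v = 1 \<or> v \<notin> {0..1}" by auto
      with False show ?thesis by (auto simp: K_def G_def)
    qed
    have "(LINT v|lborel. K v t) = Beta (of_real \<alpha> + ?s) (of_real \<beta>) * H t"
      unfolding K_eq integral_mult_left_zero using \<kappa> \<beta> by (subst Beta_integral_complex) auto
    also have "\<dots> = Gamma \<beta> * \<Phi> ?s"
      by (simp add: Beta_def \<Phi>_def H_def Gamma_complex_of_real add_ac)
    finally show ?thesis .
  qed
  have inner_t: "(LINT t|lborel. K v t) = of_real (2 * pi * z powr (- c) *
      (indicator {0..1} v * (v powr (\<alpha> + c - 1) * (1 - v) powr (\<beta> - 1) * exp (- v / z))))" for v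
  proof (cases "v \<in> {0<..1}")
    case True
    define y where "y = v / z"
    have y: "y > 0" using True z by (simp add: y_def)
    have "iexp (t * ln v) * H t = of_real (v powr (c - \<kappa>) * z powr (- c)) *
        (Gamma (Complex (c - \<kappa>) (0 + (-1) * t)) * of_real y powr (- Complex (c - \<kappa>) (0 + (-1) * t)))" for t
    proof -
      have Ln_y: "Ln (complex_of_real v / complex_of_real z) = of_real (ln v - ln z)"
        unfolding of_real_divide[symmetric] using True z by (subst Ln_of_real) (auto simp: ln_div)
      have eq: "iexp (t * ln v) * complex_of_real z powr (- Complex \<kappa> t)
          = of_real (v powr (c - \<kappa>) * z powr (- c)) * of_real y powr (- Complex (c - \<kappa>) (0 + (-1) * t))"
        using True z y
        by (simp add: powr_def Ln_of_real Complex_eq y_def Ln_y algebra_simps flip: exp_add exp_of_real)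
      show ?thesis
        unfolding H_def fun_cong[OF Gamma_refl] by (subst mult.left_commute, subst eq) (simp only: mult_ac)
    qed
    then have "(LINT t|lborel. K v t) = of_real (G v * (v powr (c - \<kappa>) * z powr (- c))) *
        (LINT t|lborel. Gamma (Complex (c - \<kappa>) (0 + (-1) * t)) * of_real y powr (- Complex (c - \<kappa>) (0 + (-1) * t)))"
      by (simp only: K_def integral_mult_right_zero of_real_mult mult.assoc)
    also have "(LINT t|lborel. Gamma (Complex (c - \<kappa>) (0 + (-1) * t)) * of_real y powr (- Complex (c - \<kappa>) (0 + (-1) * t)))
        = (LINT t|lborel. Gamma (Complex (c - \<kappa>) t) * of_real y powr (- Complex (c - \<kappa>) t))"
      by (subst lborel_integral_real_affine[of "-1" "\<lambda>t. Gamma (Complex (c - \<kappa>) t) * of_real y powr (- Complex (c - \<kappa>) t)" 0]) auto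
    also have "\<dots> = 2 * pi * exp (- y)"
      using \<kappa> y by (intro Cahen_Mellin_inversion) auto
    also have "of_real (G v * (v powr (c - \<kappa>) * z powr (- c))) * complex_of_real (2 * pi * exp (- y))
       = of_real (2 * pi * z powr (- c) *
           (indicator {0..1} v * (v powr (\<alpha> + c - 1) * (1 - v) powr (\<beta> - 1) * exp (- v / z))))"
    proof -
      have "v powr (\<alpha> + \<kappa> - 1) * v powr (c - \<kappa>) = v powr (\<alpha> + c - 1)"
        by (simp add: algebra_simps flip: powr_add)
      then show ?thesis
        unfolding of_real_mult[symmetric] of_real_eq_iff G_def y_def by (simp add: mult_ac)
    qed
    finally show ?thesis .
  next
    case False
    then have "v = 0 \<or> v \<notin> {0..1}" by auto
    then show ?thesis by (auto simp: K_def G_def)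
  qed
  have Gamma_nz: "Gamma \<beta> \<noteq> 0"
    using Gamma_real_pos[OF \<beta>] by simp
  have "integrable lborel (\<lambda>t. inverse (of_real (Gamma \<beta>)) * (of_real (Gamma \<beta>) * \<Phi> (Complex \<kappa> t)))"
    using K_int unfolding inner_v by (rule integrable_mult_right)
  then have "integrable lborel (\<lambda>t. \<Phi> (Complex \<kappa> t))"
    using Gamma_nz by (simp flip: mult.assoc)
  moreover have "(LINT t|lborel. \<Phi> (Complex \<kappa> t)) = 2 * pi * (z powr (- c) / Gamma \<beta> *
      (LINT v:{0..1}|lborel. v powr (\<alpha> + c - 1) * (1 - v) powr (\<beta> - 1) * exp (- v / z)))"
    using swap Gamma_nz unfolding inner_v inner_t integral_complex_of_real
    by (simp add: set_lebesgue_integral_def field_simps)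
  ultimately show ?thesis
    by (simp add: has_bochner_integral_iff)
qed

section \<open>The Euler integral of the confluent hypergeometric function\<close>

text \<open>
  Expanding \<open>exp (x v)\<close> and integrating term by term gives \<open>Beta (b + k) \<beta> x\<^bsup>k\<^esup> / k!\<close>. The interchange is
  justified by \<open>Beta (b + k) \<beta> \<le> Beta b \<beta>\<close>, which leaves the exponential series as a majorant. The ratio
  \<open>Beta (b + k) \<beta> / Beta b \<beta>\<close> is the quotient of the Pochhammer symbols of \<open>b\<close> and \<open>b + \<beta>\<close>.
\<close>

lemma hypergeometric_1F1_Euler_integral:
  fixes b \<beta> x :: real
  assumes b: "b > 0" and \<beta>: "\<beta> > 0"
  defines "f \<equiv> (\<lambda>v. v powr (b - 1) * (1 - v) powr (\<beta> - 1) * exp (x * v))"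
  shows "set_integrable lborel {0..1} f"
    and "(LINT v:{0..1}|lborel. f v) = Beta b \<beta> * hypergeometric_1F1 b (b + \<beta>) x"
proof -
  define B where "B k v = indicator {0..1} v *\<^sub>R (v powr (b + real k - 1) * (1 - v) powr (\<beta> - 1))" for k v
  define F where "F k v = x ^ k / fact k * B k v" for k v
  have B_int: "integrable lborel (B k)" for k
    using integrable_Beta[of "b + real k" \<beta>] b \<beta> by (simp add: B_def[abs_def] set_integrable_def)
  have B_val: "(LINT v|lborel. B k v) = Beta (b + real k) \<beta>" for k
  proof -
    have "(LINT v|lborel. B k v) = integral {0..1} (\<lambda>v. v powr (b + real k - 1) * (1 - v) powr (\<beta> - 1))"
      using set_borel_integral_eq_integral(2)[OF integrable_Beta[of "b + real k" \<beta>]] b \<beta>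
      by (simp add: B_def set_lebesgue_integral_def)
    then show ?thesis
      using has_integral_Beta_real[of "b + real k" \<beta>] b \<beta> by (simp add: integral_unique)
  qed
  have B_nonneg: "B k v \<ge> 0" for k v
    by (simp add: B_def)
  have F_int: "integrable lborel (F k)" for k
    unfolding F_def[abs_def] using B_int by (rule integrable_mult_right)
  have F_term: "F k v = indicator {0..1} v * (v powr (b - 1) * (1 - v) powr (\<beta> - 1)) * ((x * v) ^ k /\<^sub>R fact k)" for k v
  proof (cases "0 < v")
    case True
    then have "v powr (b + real k - 1) = v powr (b - 1) * v ^ k"
      by (simp add: powr_add powr_diff powr_realpow)
    then show ?thesis
      by (simp add: F_def B_def power_mult_distrib field_simps)
  next
    case False
    then have "v = 0 \<or> v \<notin> {0..1}" by auto
    then show ?thesis by (auto simp: F_def B_def)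
  qed
  have F_sums: "(\<lambda>k. F k v) sums (indicator {0..1} v * f v)" for v
    using sums_mult[OF exp_converges[of "x * v"], of "indicator {0..1} v * (v powr (b - 1) * (1 - v) powr (\<beta> - 1))"]
    by (simp add: F_term f_def mult_ac)
  have F_norm_summable: "summable (\<lambda>k. norm (F k v))" for v
    using summable_mult[OF summable_norm_exp[of "x * v"], of "norm (indicator {0..1} v * (v powr (b - 1) * (1 - v) powr (\<beta> - 1)))"]
    by (simp add: F_term norm_mult abs_mult)
  have norm_int: "(LINT v|lborel. norm (F k v)) = \<bar>x\<bar> ^ k / fact k * Beta (b + real k) \<beta>" for k
    using B_nonneg[of k] B_val[of k] by (simp add: F_def abs_mult power_abs)
  have int_summable: "summable (\<lambda>k. LINT v|lborel. norm (F k v))"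
  proof (rule summable_comparison_test')
    show "summable (\<lambda>k. \<bar>x\<bar> ^ k / fact k * Beta b \<beta>)"
      using summable_mult2[OF summable_exp[of "\<bar>x\<bar>"]] by (simp add: field_simps)
    show "norm (LINT v|lborel. norm (F k v)) \<le> \<bar>x\<bar> ^ k / fact k * Beta b \<beta>" if "k \<ge> 0" for k
    proof -
      have "Beta (b + real k) \<beta> \<le> Beta b \<beta>"
        using b \<beta> by (intro Beta_real_mono) auto
      moreover have "0 \<le> Beta (b + real k) \<beta>"
        unfolding B_val[symmetric] using B_nonneg by (intro Bochner_Integration.integral_nonneg)
      ultimately show ?thesis
        unfolding norm_int by (simp add: abs_mult mult_left_mono divide_right_mono)
    qed
  qed
  note suminf_rules = F_int AE_I2[OF F_norm_summable] int_summable
  have suminf_F: "(\<Sum>k. F k v) = indicator {0..1} v * f v" for v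
    using F_sums by (rule sums_unique[symmetric])
  show "set_integrable lborel {0..1} f"
    using integrable_suminf[OF suminf_rules] by (simp add: suminf_F set_integrable_def)
  have coeff: "(LINT v|lborel. F k v) = Beta b \<beta> * (fps_hypergeo [b] [b + \<beta>] 1 $ k * x ^ k)" for k
  proof -
    have Gamma_nz: "Gamma y \<noteq> 0" if "y > 0" for y :: real
      using Gamma_real_pos[OF that] by linarith
    have "b \<notin> \<int>\<^sub>\<le>\<^sub>0" "b + \<beta> \<notin> \<int>\<^sub>\<le>\<^sub>0"
      using b \<beta> by (auto elim!: nonpos_Ints_cases)
    with Gamma_nz[of b] Gamma_nz[of "b + \<beta>"] Gamma_nz[of "b + \<beta> + real k"] b \<beta>
    have "Beta (b + real k) \<beta> = Beta b \<beta> * (pochhammer b k / pochhammer (b + \<beta>) k)"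
      by (simp add: Beta_def pochhammer_Gamma field_simps)
    then show ?thesis
      using B_val[of k] by (simp add: F_def field_simps)
  qed
  define h where "h k = fps_hypergeo [b] [b + \<beta>] 1 $ k * x ^ k" for k
  have sums: "(\<lambda>k. Beta b \<beta> * h k) sums (LINT v:{0..1}|lborel. f v)"
    using sums_integral[OF suminf_rules] unfolding coeff h_def[symmetric] suminf_F
    by (simp add: set_lebesgue_integral_def)
  have "Beta b \<beta> \<noteq> 0"
    unfolding Beta_def using b \<beta> by (intro less_imp_neq[symmetric] divide_pos_pos mult_pos_pos Gamma_real_pos) auto
  then have "summable h"
    using sums_summable[OF sums] by simp
  then show "(LINT v:{0..1}|lborel. f v) = Beta b \<beta> * hypergeometric_1F1 b (b + \<beta>) x"
    using sums_unique[OF sums] unfolding hypergeometric_1F1_def eval_fps_def h_def[symmetric]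
    by (simp add: suminf_mult)
qed

section \<open>Poles, separating lines and uniqueness of the value\<close>

lemma has_meijer_G_unique:
  assumes "has_meijer_G m n as bs z w" "has_meijer_G m n as bs z w'"
  shows "w = w'"
proof -
  obtain \<kappa> where "meijer_G_separating m n as bs \<kappa>"
    using assms(1) unfolding has_meijer_G_def by blast
  then have "2 * of_real pi * \<i> * w = 2 * of_real pi * \<i> * w'"
    using assms unfolding has_meijer_G_def by (blast intro: has_integral_unique)
  then show ?thesis by simp
qed

lemma meijer_G_eqI: "has_meijer_G m n as bs z w \<Longrightarrow> meijer_G m n as bs z = w"
  unfolding meijer_G_def by (blast intro: has_meijer_G_unique)

lemma is_pole_Gamma_iff: "is_pole Gamma z \<longleftrightarrow> z \<in> (\<int>\<^sub>\<le>\<^sub>0 :: complex set)"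
proof
  show "z \<in> \<int>\<^sub>\<le>\<^sub>0" if "is_pole Gamma z"
  proof (rule ccontr)
    assume "z \<notin> \<int>\<^sub>\<le>\<^sub>0"
    then have "Gamma holomorphic_on - \<int>\<^sub>\<le>\<^sub>0" "open (- \<int>\<^sub>\<le>\<^sub>0 :: complex set)" "z \<in> - \<int>\<^sub>\<le>\<^sub>0"
      by (auto intro: holomorphic_Gamma)
    then show False using not_is_pole_holomorphic that by blast
  qed
qed (auto elim!: nonpos_Ints_cases' simp: is_pole_Gamma)

lemma is_pole_Gamma_plus_iff: "is_pole (\<lambda>s. Gamma (b + s)) s \<longleftrightarrow> b + s \<in> (\<int>\<^sub>\<le>\<^sub>0 :: complex set)"
  using is_pole_shift_iff[of Gamma b s] by (simp add: o_def is_pole_Gamma_iff add.commute)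

lemma is_pole_Gamma_minus_iff: "is_pole (\<lambda>s. Gamma (c - s)) s \<longleftrightarrow> c - s \<in> (\<int>\<^sub>\<le>\<^sub>0 :: complex set)"
proof -
  have "is_pole (\<lambda>s. Gamma (c - s)) s \<longleftrightarrow> is_pole (\<lambda>h. Gamma (c - s - h)) 0"
    by (subst is_pole_shift_0) (simp add: algebra_simps)
  also have "\<dots> \<longleftrightarrow> is_pole ((\<lambda>h. Gamma (c - s + h)) \<circ> uminus) 0"
    by (simp add: o_def)
  also have "\<dots> \<longleftrightarrow> is_pole (\<lambda>h. Gamma (c - s + h)) 0"
    by (rule is_pole_compose_iff) (use filtermap_at_minus[of "0::complex"] in simp)
  finally show ?thesis by (simp add: is_pole_Gamma_plus_iff)
qed

text \<open>
  The poles nearest to the line are \<open>-b\<close> on the left and \<open>1 - a\<close> on the right; all others are shifts of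
  these by natural numbers, away from the line.
\<close>

lemma meijer_G_separating_11_iff:
  fixes a b \<kappa> :: real
  shows "meijer_G_separating 1 1 [of_real a, d] [of_real b] \<kappa> \<longleftrightarrow> - b < \<kappa> \<and> \<kappa> < 1 - a"
proof -
  have "meijer_G_separating 1 1 [of_real a, d] [of_real b] \<kappa> \<longleftrightarrow>
      (\<forall>s. of_real b + s \<in> \<int>\<^sub>\<le>\<^sub>0 \<longrightarrow> Re s < \<kappa>) \<and> (\<forall>s. of_real (1 - a) - s \<in> \<int>\<^sub>\<le>\<^sub>0 \<longrightarrow> \<kappa> < Re s)"
    by (simp add: meijer_G_separating_def is_pole_Gamma_plus_iff is_pole_Gamma_minus_iff)
  also have "\<dots> \<longleftrightarrow> - b < \<kappa> \<and> \<kappa> < 1 - a"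
  proof (intro iffI conjI allI impI; (elim conjE)?)
    assume "\<forall>s. of_real b + s \<in> \<int>\<^sub>\<le>\<^sub>0 \<longrightarrow> Re s < \<kappa>"
    from this[rule_format, of "- of_real b"] show "- b < \<kappa>" by simp
  next
    assume "\<forall>s. of_real (1 - a) - s \<in> \<int>\<^sub>\<le>\<^sub>0 \<longrightarrow> \<kappa> < Re s"
    from this[rule_format, of "of_real (1 - a)"] show "\<kappa> < 1 - a" by simp
  next
    fix s :: complex assume "- b < \<kappa>" "of_real b + s \<in> \<int>\<^sub>\<le>\<^sub>0"
    with Re_pos_not_nonpos_Int[of "of_real b + s"] show "Re s < \<kappa>" by force
  next
    fix s :: complex assume "\<kappa> < 1 - a" "of_real (1 - a) - s \<in> \<int>\<^sub>\<le>\<^sub>0"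
    with Re_pos_not_nonpos_Int[of "of_real (1 - a) - s"] show "\<kappa> < Re s" by force
  qed
  finally show ?thesis .
qed

section \<open>The integral and hypergeometric forms of the G-function\<close>

theorem theorem3p4:
  fixes a \<alpha> \<beta> \<gamma> u :: real
  assumes "a > 0" and "\<beta> > 0" and "\<alpha> > -1" and "\<gamma> > -1" and "u > 0"
  defines "G \<equiv> meijer_G 1 1 [of_real (-1 - \<gamma>), of_real (\<alpha> + \<beta>)] [of_real \<alpha>] (u / a)"
    and "f1 \<equiv> (\<lambda>v. v powr (\<alpha> + \<gamma> + 1) * (1 - v) powr (\<beta> - 1) * exp (- a * v / u))"
    and "f2 \<equiv> (\<lambda>v. v powr (\<alpha> + \<gamma> + 1) * (1 - u * v) powr (\<beta> - 1) * exp (- a * v))"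
  shows "has_meijer_G 1 1 [of_real (-1 - \<gamma>), of_real (\<alpha> + \<beta>)] [of_real \<alpha>] (u / a) G
    \<and> f1 integrable_on {0..1} \<and> f2 integrable_on {0..1 / u}
    \<and> G = complex_of_real
        (a powr (\<gamma> + 2) / Gamma \<beta> * u powr (- \<gamma> - 2) * integral {0..1} f1)
    \<and> a powr (\<gamma> + 2) / Gamma \<beta> * u powr (- \<gamma> - 2) * integral {0..1} f1
      = a powr (\<gamma> + 2) / Gamma \<beta> * u powr \<alpha> * integral {0..1 / u} f2
    \<and> a powr (\<gamma> + 2) / Gamma \<beta> * u powr \<alpha> * integral {0..1 / u} f2
      = Gamma (2 + \<alpha> + \<gamma>) / Gamma (2 + \<alpha> + \<gamma> + \<beta>) * (u / a) powr (- \<gamma> - 2)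
          * hypergeometric_1F1 (2 + \<alpha> + \<gamma>) (2 + \<alpha> + \<gamma> + \<beta>) (- a / u)"
proof -
  define b where "b = 2 + \<alpha> + \<gamma>"
  have b: "b > 0" using assms(3,4) by (simp add: b_def)
  have Gamma_nz: "Gamma \<beta> \<noteq> 0" using Gamma_real_pos[OF assms(2)] by linarith
  have f1_eq: "f1 = (\<lambda>v. v powr (b - 1) * (1 - v) powr (\<beta> - 1) * exp (- a / u * v))"
  proof -
    have "\<alpha> + \<gamma> + 1 = b - 1" "- a * v / u = - a / u * v" for v by (simp_all add: b_def)
    then show ?thesis by (simp only: f1_def)
  qed
  have f1_set: "set_integrable lborel {0..1} f1"
    unfolding f1_eq by (rule hypergeometric_1F1_Euler_integral(1)[OF b assms(2)])
  have f1_int: "f1 integrable_on {0..1}" and f1_Leb: "(LINT v:{0..1}|lborel. f1 v) = integral {0..1} f1"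
    using set_borel_integral_eq_integral[OF f1_set] by auto
  have f1_1F1: "integral {0..1} f1 = Beta b \<beta> * hypergeometric_1F1 b (b + \<beta>) (- a / u)"
    unfolding f1_Leb[symmetric] unfolding f1_eq
    by (rule hypergeometric_1F1_Euler_integral(2)[OF b assms(2)])
  have prefactor: "(u / a) powr (- \<gamma> - 2) = a powr (\<gamma> + 2) * u powr (- \<gamma> - 2)"
    using assms(1,5) powr_minus_divide[of a "\<gamma> + 2"] by (simp add: powr_divide)

  define w where "w = a powr (\<gamma> + 2) / Gamma \<beta> * u powr (- \<gamma> - 2) * integral {0..1} f1"
  have meijer: "has_meijer_G 1 1 [of_real (-1 - \<gamma>), of_real (\<alpha> + \<beta>)] [of_real \<alpha>] (u / a) (of_real w)"
    unfolding has_meijer_G_def meijer_G_separating_11_iff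
  proof (intro conjI allI impI; (elim conjE)?)
    show "\<exists>\<kappa>. - \<alpha> < \<kappa> \<and> \<kappa> < 1 - (-1 - \<gamma>)"
      \<comment> \<open>\<open>\<alpha>, \<gamma> > -1\<close> put 1 strictly between \<open>-\<alpha>\<close> and \<open>2 + \<gamma>\<close>.\<close>
      using assms(3,4) by (intro exI[of _ 1]) simp
  next
    fix \<kappa> assume \<kappa>: "- \<alpha> < \<kappa>" "\<kappa> < 1 - (-1 - \<gamma>)"
    let ?\<Phi> = "\<lambda>s. Gamma (of_real \<alpha> + s) * Gamma (of_real (\<gamma> + 2) - s) / Gamma (of_real (\<alpha> + \<beta>) + s)
                  * complex_of_real (u / a) powr (- s)"
    have integrand: "meijer_G_integrand 1 1 [of_real (-1 - \<gamma>), of_real (\<alpha> + \<beta>)] [of_real \<alpha>] (u / a) s = ?\<Phi> s" for s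
      by (simp add: meijer_G_integrand_def add_ac)
    have f1_z: "f1 v = v powr (\<alpha> + (\<gamma> + 2) - 1) * (1 - v) powr (\<beta> - 1) * exp (- v / (u / a))" for v
    proof -
      have "\<alpha> + (\<gamma> + 2) - 1 = \<alpha> + \<gamma> + 1" "- v / (u / a) = - a * v / u" by simp_all
      then show ?thesis by (simp only: f1_def)
    qed
    have "has_bochner_integral lborel (\<lambda>t. ?\<Phi> (Complex \<kappa> t))
        (2 * pi * ((u / a) powr (- (\<gamma> + 2)) / Gamma \<beta> * (LINT v:{0..1}|lborel. f1 v)))"
      unfolding f1_z by (rule Gamma_quotient_vertical_integral) (use assms \<kappa> in auto)
    then have hb: "has_bochner_integral lborel (\<lambda>t. ?\<Phi> (Complex \<kappa> t)) (2 * pi * w)"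
      using prefactor by (simp add: w_def f1_Leb mult_ac)
    from has_integral_integral_lborel[OF integrable.intros[OF hb]]
    have "((\<lambda>t. ?\<Phi> (Complex \<kappa> t)) has_integral (2 * pi * w)) UNIV"
      unfolding has_bochner_integral_integral_eq[OF hb] .
    then have "((\<lambda>t. ?\<Phi> (Complex \<kappa> t) * \<i>) has_integral (2 * pi * w * \<i>)) UNIV"
      by (rule has_integral_mult_left)
    then show "((\<lambda>t. meijer_G_integrand 1 1 [of_real (-1 - \<gamma>), of_real (\<alpha> + \<beta>)] [of_real \<alpha>] (u / a) (Complex \<kappa> t) * \<i>)
        has_integral 2 * of_real pi * \<i> * of_real w) UNIV"
      unfolding integrand by (simp add: mult_ac)
  qed
  have G: "G = of_real w"
    unfolding G_def by (rule meijer_G_eqI[OF meijer])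

  have "((\<lambda>v. u powr - (\<alpha> + \<gamma> + 1) * f1 (u * v)) has_integral
          u powr - (\<alpha> + \<gamma> + 1) * ((1 / u) * integral {0..1} f1)) {0..1 / u}"
    using has_integral_stretch_real[OF integrable_integral[OF f1_int], of u] assms(5)
    by (intro has_integral_mult_right) (simp add: image_divide_atLeastAtMost)
  moreover have "u powr - (\<alpha> + \<gamma> + 1) * f1 (u * v) = f2 v" if "v \<in> {0..1 / u}" for v
  proof -
    have "f1 (u * v) = u powr (\<alpha> + \<gamma> + 1) * f2 v"
      using that assms(5) by (simp add: f1_def f2_def powr_mult)
    moreover have "u powr - (\<alpha> + \<gamma> + 1) * u powr (\<alpha> + \<gamma> + 1) = 1"
      using assms(5) by (simp only: powr_add[symmetric]) simp
    ultimately show ?thesis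
      by (simp only: mult.assoc[symmetric] mult_1)
  qed
  ultimately have f2: "(f2 has_integral u powr - (\<alpha> + \<gamma> + 1) * ((1 / u) * integral {0..1} f1)) {0..1 / u}"
    by (rule has_integral_eq[rotated])
  have "u powr \<alpha> * (u powr - (\<alpha> + \<gamma> + 1) * (1 / u)) = u powr (- \<gamma> - 2)"
  proof -
    have "1 / u = u powr (- 1)" using assms(5) by (simp add: powr_minus_divide)
    moreover have "\<alpha> + (- (\<alpha> + \<gamma> + 1) + - 1) = - \<gamma> - 2" by simp
    ultimately show ?thesis by (simp only: powr_add[symmetric])
  qed
  then have f2_f1: "u powr \<alpha> * integral {0..1 / u} f2 = u powr (- \<gamma> - 2) * integral {0..1} f1"
    unfolding integral_unique[OF f2] by (simp only: mult.assoc[symmetric])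
  have scaled: "a powr (\<gamma> + 2) / Gamma \<beta> * u powr (- \<gamma> - 2) * integral {0..1} f1
      = a powr (\<gamma> + 2) / Gamma \<beta> * u powr \<alpha> * integral {0..1 / u} f2"
    by (simp only: mult.assoc f2_f1)
  have "a powr (\<gamma> + 2) / Gamma \<beta> * u powr (- \<gamma> - 2) * integral {0..1} f1
      = Gamma b / Gamma (b + \<beta>) * (u / a) powr (- \<gamma> - 2) * hypergeometric_1F1 b (b + \<beta>) (- a / u)"
    unfolding f1_1F1 prefactor Beta_def using Gamma_nz by simp
  from scaled[symmetric, THEN trans, OF this] show ?thesis
    using meijer f1_int has_integral_integrable[OF f2] scaled unfolding G w_def b_def by blast
qed

end
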